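(* Let $m,n$ be positive integers with $n=\prod_{i=1}^m n_i$, where each $n_i>1$ is an integer, and let $g:\{0,\ldots,n-1\}\to\{0,\ldots,n-1\}$ be a Costas permutation of order $n$. For $i\in\{0,\ldots,n-1\}$ write $i=\sum_{j=1}^m v_j(i)\prod_{l=j+1}^m n_l$ with $v_j(i)\in\{0,\ldots,n_j-1\}$ for $1\le j\le m$ (mixed-radix expansion; the empty product is $1$), so that $i$ is mapped bijectively to $V(i)=(v_1(i),\ldots,v_m(i))$. Then the hyper-rectangle in $2m$ dimensions, with side length $n_i$ in dimensions $i$ and $i+m$ for $1\le i\le m$, whose dots ($n$ in total) lie at the points $$(V(i),V(g(i)))=(v_1(i),\ldots,v_m(i),v_1(g(i)),\ldots,v_m(g(i))),\qquad i\in\{0,\ldots,n-1\},$$ is a permutation Costas hyper-rectangle.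
   Context: A Costas permutation of order $n$ on $\{0,\ldots,n-1\}$ is a bijection $g:\{0,\ldots,n-1\}\to\{0,\ldots,n-1\}$ such that the vectors $(i-j,\,g(i)-g(j))$, for $i<j$ in $\{0,\ldots,n-1\}$, are pairwise distinct. A binary function $f:\mathbb{Z}^d\to\{0,1\}$ with finite support (points where $f=1$ are called dots) has the Costas property if its autocorrelation $A_f(k)=\sum_{i\in\mathbb{Z}^d}f(i)f(i+k)$ satisfies $A_f(k)\le 1$ for all $k\in\mathbb{Z}^d\setminus\{0\}$. Equivalently, the difference vectors between ordered pairs of different dots are pairwise distinct. A permutation Costas hyper-rectangle with side length $n_i$ in dimensions $i$ and $i+m$ ($1\le i\le m$) is (with coordinates starting from $0$) a function $f:\mathbb{Z}^{2m}\to\{0,1\}$ with the Costas property for which there is a bijection $h:\prod_{i=1}^m\{0,\ldots,n_i-1\}\to\prod_{i=1}^m\{0,\ldots,n_i-1\}$ such that $f(w)=1$ if and only if $(w_1,\ldots,w_m)\in\prod_{i=1}^m\{0,\ldots,n_i-1\}$ and $(w_{m+1},\ldots,w_{2m})=h(w_1,\ldots,w_m)$. *)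

theory Defs
  imports "HOL-Analysis.Infinite_Sum" "HOL-Library.FuncSet"
begin

definition costas_permutation :: "nat \<Rightarrow> (nat \<Rightarrow> nat) \<Rightarrow> bool" where
  "costas_permutation n g \<longleftrightarrow>
     bij_betw g {0..<n} {0..<n} \<and>
     inj_on (\<lambda>(i, j). (int i - int j, int (g i) - int (g j))) {(i, j). i < j \<and> j < n}"

text \<open>
  Points of the \<open>d\<close>-dimensional integer lattice are the functions on the coordinate set
  \<open>{1..d}\<close>, extended by \<open>undefined\<close> outside of it, so that equality of points is equality
  of functions. A function on the lattice is an arbitrary function on \<^typ>\<open>nat \<Rightarrow> int\<close> of
  which only the values at lattice points are ever used.
\<close>

definition lattice :: "nat \<Rightarrow> (nat \<Rightarrow> int) set" where
  "lattice d = {1..d} \<rightarrow>\<^sub>E UNIV"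

definition vzero :: "nat \<Rightarrow> nat \<Rightarrow> int" where
  "vzero d = (\<lambda>i\<in>{1..d}. 0)"

definition vplus :: "nat \<Rightarrow> (nat \<Rightarrow> int) \<Rightarrow> (nat \<Rightarrow> int) \<Rightarrow> nat \<Rightarrow> int" where
  "vplus d x y = (\<lambda>i\<in>{1..d}. x i + y i)"

definition autocorrelation :: "nat \<Rightarrow> ((nat \<Rightarrow> int) \<Rightarrow> nat) \<Rightarrow> (nat \<Rightarrow> int) \<Rightarrow> nat" where
  "autocorrelation d f k = (\<Sum>\<^sub>\<infinity>i\<in>lattice d. f i * f (vplus d i k))"

definition dots :: "nat \<Rightarrow> ((nat \<Rightarrow> int) \<Rightarrow> nat) \<Rightarrow> (nat \<Rightarrow> int) set" where
  "dots d f = {w \<in> lattice d. f w = 1}"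

text \<open>
  Finiteness of the support is part of the property: without it the infinite sum could
  diverge, in which case \<^const>\<open>infsum\<close> is \<open>0\<close>.
\<close>

definition costas_property :: "nat \<Rightarrow> ((nat \<Rightarrow> int) \<Rightarrow> nat) \<Rightarrow> bool" where
  "costas_property d f \<longleftrightarrow>
     f \<in> lattice d \<rightarrow> {0, 1} \<and> finite (dots d f) \<and>
     (\<forall>k \<in> lattice d - {vzero d}. autocorrelation d f k \<le> 1)"

definition box :: "nat \<Rightarrow> (nat \<Rightarrow> nat) \<Rightarrow> (nat \<Rightarrow> int) set" where
  "box m N = (\<Pi>\<^sub>E i\<in>{1..m}. {0..<int (N i)})"

definition first_half :: "nat \<Rightarrow> (nat \<Rightarrow> int) \<Rightarrow> nat \<Rightarrow> int" where
  "first_half m w = (\<lambda>i\<in>{1..m}. w i)"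

definition second_half :: "nat \<Rightarrow> (nat \<Rightarrow> int) \<Rightarrow> nat \<Rightarrow> int" where
  "second_half m w = (\<lambda>i\<in>{1..m}. w (m + i))"

definition vconcat :: "nat \<Rightarrow> (nat \<Rightarrow> int) \<Rightarrow> (nat \<Rightarrow> int) \<Rightarrow> nat \<Rightarrow> int" where
  "vconcat m x y = (\<lambda>i\<in>{1..2 * m}. if i \<le> m then x i else y (i - m))"

definition permutation_costas_hyperrectangle ::
    "nat \<Rightarrow> (nat \<Rightarrow> nat) \<Rightarrow> ((nat \<Rightarrow> int) \<Rightarrow> nat) \<Rightarrow> bool" where
  "permutation_costas_hyperrectangle m N f \<longleftrightarrow>
     costas_property (2 * m) f \<and>
     (\<exists>h. bij_betw h (box m N) (box m N) \<and>
        (\<forall>w \<in> lattice (2 * m).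
           f w = 1 \<longleftrightarrow> first_half m w \<in> box m N \<and> second_half m w = h (first_half m w)))"

definition mixed_radix_expansion ::
    "nat \<Rightarrow> (nat \<Rightarrow> nat) \<Rightarrow> nat \<Rightarrow> (nat \<Rightarrow> int) \<Rightarrow> bool" where
  "mixed_radix_expansion m N i v \<longleftrightarrow>
     v \<in> box m N \<and> int i = (\<Sum>j = 1..m. v j * (\<Prod>l = j + 1..m. int (N l)))"

definition mixed_radix :: "nat \<Rightarrow> (nat \<Rightarrow> nat) \<Rightarrow> nat \<Rightarrow> nat \<Rightarrow> int" where
  "mixed_radix m N i = (THE v. mixed_radix_expansion m N i v)"

definition radix_hyperrectangle ::
    "nat \<Rightarrow> (nat \<Rightarrow> nat) \<Rightarrow> nat \<Rightarrow> (nat \<Rightarrow> nat) \<Rightarrow> (nat \<Rightarrow> int) \<Rightarrow> nat" where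
  "radix_hyperrectangle m N n g w =
     (if \<exists>i\<in>{0..<n}. w = vconcat m (mixed_radix m N i) (mixed_radix m N (g i)) then 1 else 0)"

end

theory Submission
  imports Defs
begin

text \<open>
  Let \<open>R v = (\<Sum>j. v\<^sub>j (\<Prod>l>j. N\<^sub>l))\<close> be the value of a digit vector \<open>v\<close>. Two facts about \<open>R\<close> carry
  the proof. It is a bijection from the box onto \<open>{0..<n}\<close> (lemma \<open>radix_value_bij\<close>), with
  inverse \<open>mixed_radix\<close>; and it is additive on all of \<open>\<int>\<^sup>m\<close>, also on differences of
  digit vectors, whose entries may be negative.

  Suppose that a nonzero vector \<open>k\<close> joins the dot of \<open>a\<close> to the dot of \<open>b\<close>, and also the dot of
  \<open>c\<close> to the dot of \<open>d\<close>. Applying \<open>R\<close> to both halves of \<open>k\<close> gives \<open>b - a = d - c\<close> and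
  \<open>g b - g a = g d - g c\<close>, so the hyper-rectangle inherits distinctness of differences from the
  Costas permutation \<open>g\<close>, which forces \<open>a = c\<close> (lemma \<open>costas_permutation_difference_inj\<close>).
  The same bijection transports \<open>g\<close> to the bijection \<open>mixed_radix \<circ> g \<circ> R\<close> of the box
  whose graph is the set of dots.
\<close>

section \<open>Mixed-radix expansions\<close>

definition radix_value :: "nat \<Rightarrow> (nat \<Rightarrow> nat) \<Rightarrow> (nat \<Rightarrow> int) \<Rightarrow> int" where
  "radix_value m N v = (\<Sum>j = 1..m. v j * (\<Prod>l = j + 1..m. int (N l)))"

text \<open>
  Horner's rule. The last entry of \<open>v\<close> is the least significant digit, so the inductions on the
  number of digits below split off that digit as a remainder modulo its radix.
\<close>

lemma radix_value_Suc:
  "radix_value (Suc m) N v = radix_value m N v * int (N (Suc m)) + v (Suc m)"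
proof -
  have "(\<Sum>j = 1..m. v j * (\<Prod>l = j + 1..Suc m. int (N l))) =
      (\<Sum>j = 1..m. v j * (\<Prod>l = j + 1..m. int (N l)) * int (N (Suc m)))"
    by (intro sum.cong) (auto simp: prod.nat_ivl_Suc')
  then show ?thesis
    by (simp add: radix_value_def sum_distrib_right)
qed

lemma radix_value_add:
  "radix_value m N (\<lambda>j. v j + w j) = radix_value m N v + radix_value m N w"
  by (simp add: radix_value_def sum.distrib distrib_right)

lemma radix_value_cong:
  "(\<And>j. j \<in> {1..m} \<Longrightarrow> v j = w j) \<Longrightarrow> radix_value m N v = radix_value m N w"
  by (simp add: radix_value_def)

lemma radix_value_bounds:
  assumes "\<And>j. j \<in> {1..m} \<Longrightarrow> 0 \<le> v j \<and> v j < int (N j)"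
  shows "0 \<le> radix_value m N v \<and> radix_value m N v < (\<Prod>j = 1..m. int (N j))"
  using assms
proof (induction m)
  case 0
  then show ?case by (simp add: radix_value_def)
next
  case (Suc m)
  let ?R = "radix_value m N v" and ?P = "\<Prod>j = 1..m. int (N j)" and ?b = "int (N (Suc m))"
  have IH: "0 \<le> ?R" "?R < ?P"
    using Suc by auto
  have digit: "0 \<le> v (Suc m)" "v (Suc m) < ?b"
    using Suc.prems by auto
  have "(?R + 1) * ?b \<le> ?P * ?b"
    using IH by (intro mult_right_mono) auto
  then have "?R * ?b + v (Suc m) < ?P * ?b"
    using digit by (simp add: distrib_right)
  moreover have "0 \<le> ?R * ?b + v (Suc m)"
    using IH digit by simp
  ultimately show ?case
    by (simp add: radix_value_Suc mult.commute)
qed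

lemma radix_value_digits_unique:
  assumes "\<And>j. j \<in> {1..m} \<Longrightarrow> 0 \<le> v j \<and> v j < int (N j)"
    and "\<And>j. j \<in> {1..m} \<Longrightarrow> 0 \<le> w j \<and> w j < int (N j)"
    and "radix_value m N v = radix_value m N w"
  shows "\<forall>j\<in>{1..m}. v j = w j"
  using assms
proof (induction m)
  case 0
  then show ?case by simp
next
  case (Suc m)
  let ?b = "int (N (Suc m))"
  have v: "0 \<le> v (Suc m)" "v (Suc m) < ?b" and w: "0 \<le> w (Suc m)" "w (Suc m) < ?b"
    using Suc.prems(1,2) by auto
  have eq: "radix_value m N v * ?b + v (Suc m) = radix_value m N w * ?b + w (Suc m)"
    using Suc.prems(3) by (simp add: radix_value_Suc)
  have "v (Suc m) = (radix_value m N v * ?b + v (Suc m)) mod ?b"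
    using v by simp
  also have "\<dots> = w (Suc m)"
    unfolding eq using w by simp
  finally have last: "v (Suc m) = w (Suc m)" .
  then have "radix_value m N v = radix_value m N w"
    using eq v by simp
  then have "\<forall>j\<in>{1..m}. v j = w j"
    using Suc.prems(1,2) by (intro Suc.IH) auto
  with last show ?case
    by (auto simp: atLeastAtMostSuc_conv)
qed

text \<open>
  Surjectivity follows from injectivity by counting: the box has exactly as many points as the
  interval.
\<close>

lemma radix_value_bij:
  "bij_betw (radix_value m N) (box m N) {0..<int (\<Prod>i = 1..m. N i)}"
proof -
  have digits: "0 \<le> v j \<and> v j < int (N j)" if "v \<in> box m N" "j \<in> {1..m}" for v j
    using PiE_mem[OF that(1)[unfolded box_def] that(2)] by simp
  have inj: "inj_on (radix_value m N) (box m N)"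
  proof (rule inj_onI)
    fix v w
    assume vw: "v \<in> box m N" "w \<in> box m N" and eq: "radix_value m N v = radix_value m N w"
    have "\<forall>j\<in>{1..m}. v j = w j"
      using digits vw eq by (intro radix_value_digits_unique) auto
    then show "v = w"
      using vw unfolding box_def by (intro PiE_ext) auto
  qed
  have sub: "radix_value m N ` box m N \<subseteq> {0..<int (\<Prod>i = 1..m. N i)}"
    using radix_value_bounds[of m _ N] digits by auto
  have "card (radix_value m N ` box m N) = card {0..<int (\<Prod>i = 1..m. N i)}"
    by (simp add: card_image[OF inj]) (simp add: box_def card_PiE flip: of_nat_prod)
  then have "radix_value m N ` box m N = {0..<int (\<Prod>i = 1..m. N i)}"
    by (intro card_subset_eq sub) auto
  with inj show ?thesis
    by (simp add: bij_betw_def)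
qed

lemma mixed_radix_expansion_iff:
  "mixed_radix_expansion m N i v \<longleftrightarrow> v \<in> box m N \<and> radix_value m N v = int i"
  by (auto simp: mixed_radix_expansion_def radix_value_def)

lemma mixed_radix_expansion_ex1:
  assumes "i < (\<Prod>i = 1..m. N i)"
  shows "\<exists>!v. mixed_radix_expansion m N i v"
proof -
  have "int i \<in> {0..<int (\<Prod>i = 1..m. N i)}"
    using assms by (simp del: of_nat_prod)
  then have "\<exists>!v. v \<in> box m N \<and> radix_value m N v = int i"
    using radix_value_bij[of m N] unfolding bij_betw_def inj_on_def by (metis (no_types) imageE)
  then show ?thesis
    by (simp add: mixed_radix_expansion_iff)
qed

lemma
  assumes "i < (\<Prod>i = 1..m. N i)"
  shows mixed_radix_in_box: "mixed_radix m N i \<in> box m N"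
    and radix_value_mixed_radix: "radix_value m N (mixed_radix m N i) = int i"
proof -
  have "mixed_radix_expansion m N i (mixed_radix m N i)"
    unfolding mixed_radix_def by (rule theI'[OF mixed_radix_expansion_ex1[OF assms]])
  then show "mixed_radix m N i \<in> box m N" "radix_value m N (mixed_radix m N i) = int i"
    by (simp_all add: mixed_radix_expansion_iff)
qed

lemma mixed_radix_radix_value:
  assumes "v \<in> box m N"
  shows "nat (radix_value m N v) < (\<Prod>i = 1..m. N i)"
    and "mixed_radix m N (nat (radix_value m N v)) = v"
proof -
  have range: "radix_value m N v \<in> {0..<int (\<Prod>i = 1..m. N i)}"
    using bij_betwE[OF radix_value_bij] assms by blast
  then show less: "nat (radix_value m N v) < (\<Prod>i = 1..m. N i)"
    by (simp del: of_nat_prod add: nat_less_iff)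
  have "mixed_radix_expansion m N (nat (radix_value m N v)) v"
    using assms range by (simp add: mixed_radix_expansion_iff)
  then show "mixed_radix m N (nat (radix_value m N v)) = v"
    unfolding mixed_radix_def by (rule the1_equality[OF mixed_radix_expansion_ex1[OF less]])
qed

lemma mixed_radix_bij:
  "bij_betw (mixed_radix m N) {0..<(\<Prod>i = 1..m. N i)} (box m N)"
  by (rule bij_betw_byWitness[where f' = "\<lambda>v. nat (radix_value m N v)"])
    (auto simp: radix_value_mixed_radix mixed_radix_radix_value mixed_radix_in_box
      simp del: One_nat_def)

section \<open>Halves of lattice points\<close>

lemma vconcat_in_lattice: "vconcat m x y \<in> lattice (2 * m)"
  by (auto simp: vconcat_def lattice_def)

lemma first_half_vconcat: "x \<in> box m N \<Longrightarrow> first_half m (vconcat m x y) = x"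
  by (rule ext) (auto simp: first_half_def vconcat_def box_def PiE_def extensional_def)

lemma second_half_vconcat: "y \<in> box m N \<Longrightarrow> second_half m (vconcat m x y) = y"
  by (rule ext) (auto simp: second_half_def vconcat_def box_def PiE_def extensional_def)

lemma vconcat_halves:
  "w \<in> lattice (2 * m) \<Longrightarrow> vconcat m (first_half m w) (second_half m w) = w"
  by (rule ext)
    (auto simp: first_half_def second_half_def vconcat_def lattice_def PiE_def extensional_def)

lemma radix_value_first_half_vplus:
  "radix_value m N (first_half m (vplus (2 * m) w k)) =
    radix_value m N (first_half m w) + radix_value m N (first_half m k)"
  unfolding radix_value_add[symmetric]
  by (rule radix_value_cong) (auto simp: first_half_def vplus_def)

lemma radix_value_second_half_vplus:
  "radix_value m N (second_half m (vplus (2 * m) w k)) =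
    radix_value m N (second_half m w) + radix_value m N (second_half m k)"
  unfolding radix_value_add[symmetric]
  by (rule radix_value_cong) (auto simp: second_half_def vplus_def)

section \<open>The Costas property\<close>

text \<open>
  The autocorrelation of a 0-1 function at \<open>k\<close> counts the dots that \<open>k\<close> translates to dots, so it
  is at most 1 if there is at most one such dot.
\<close>

lemma costas_propertyI:
  assumes f: "f \<in> lattice d \<rightarrow> {0, 1}" and fin: "finite (dots d f)"
    and unique: "\<And>w w' k. \<lbrakk>k \<in> lattice d; k \<noteq> vzero d; w \<in> dots d f; w' \<in> dots d f;
      vplus d w k \<in> dots d f; vplus d w' k \<in> dots d f\<rbrakk> \<Longrightarrow> w = w'"
  shows "costas_property d f"
proof -
  have "autocorrelation d f k \<le> 1" if k: "k \<in> lattice d - {vzero d}" for k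
  proof -
    let ?S = "{w \<in> dots d f. vplus d w k \<in> dots d f}"
    have vplus: "vplus d w k \<in> lattice d" for w
      by (auto simp: vplus_def lattice_def)
    have off: "f w * f (vplus d w k) = 0" if "w \<in> lattice d - ?S" for w
    proof -
      have "f w \<noteq> 1 \<or> f (vplus d w k) \<noteq> 1"
        using that vplus[of w] by (auto simp: dots_def)
      moreover have "f w \<in> {0, 1}" "f (vplus d w k) \<in> {0, 1}"
        using that vplus[of w] f by blast+
      ultimately show ?thesis by auto
    qed
    have "autocorrelation d f k = infsum (\<lambda>w. f w * f (vplus d w k)) ?S"
      unfolding autocorrelation_def
    proof (rule infsum_cong_neutral)
      show "f w * f (vplus d w k) = 0" if "w \<in> ?S - lattice d" for w
        using that by (auto simp: dots_def)
    qed (use off in auto)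
    also have "\<dots> = (\<Sum>w\<in>?S. f w * f (vplus d w k))"
      using fin by (intro infsum_finite) auto
    also have "\<dots> = card ?S"
      by (simp add: dots_def)
    also have "\<dots> \<le> 1"
      using unique[of k] k fin by (simp add: card_le_Suc0_iff_eq)
    finally show ?thesis .
  qed
  then show ?thesis
    using f fin by (auto simp: costas_property_def)
qed

text \<open>
  A Costas permutation separates the differences of pairs \<open>i < j\<close> only. Equal differences
  \<open>b - a = d - c\<close> have the same sign, so two such pairs are either both increasing or
  become so when the entries of both are swapped.
\<close>

lemma costas_permutation_difference_inj:
  assumes costas: "costas_permutation n g"
    and less: "a < n" "b < n" "c < n" "d < n" and "a \<noteq> b"
    and diff: "int b - int a = int d - int c" "int (g b) - int (g a) = int (g d) - int (g c)"
  shows "a = c"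
proof -
  have inj: "i = i' \<and> j = j'"
    if "i < j" "j < n" "i' < j'" "j' < n" "int i - int j = int i' - int j'"
      "int (g i) - int (g j) = int (g i') - int (g j')" for i j i' j'
    using costas that unfolding costas_permutation_def
    by (auto dest: inj_onD[where x = "(i, j)" and y = "(i', j')"])
  show ?thesis
  proof (cases "a < b")
    case True
    then show ?thesis
      using inj[of a b c d] less diff by linarith
  next
    case False
    then show ?thesis
      using inj[of b a d c] less diff \<open>a \<noteq> b\<close> by linarith
  qed
qed

section \<open>The hyper-rectangle of a Costas permutation\<close>

lemma dots_radix_hyperrectangle:
  "dots (2 * m) (radix_hyperrectangle m N n g) =
    (\<lambda>i. vconcat m (mixed_radix m N i) (mixed_radix m N (g i))) ` {0..<n}"
  by (auto simp: dots_def radix_hyperrectangle_def vconcat_in_lattice split: if_splits)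

theorem theorem3:
  fixes m n :: nat and N :: "nat \<Rightarrow> nat" and g :: "nat \<Rightarrow> nat"
  assumes "m > 0" and "n > 0"
    and "n = (\<Prod>i = 1..m. N i)"
    and "\<forall>i\<in>{1..m}. N i > 1"
    and "costas_permutation n g"
  shows "(\<forall>i\<in>{0..<n}. \<exists>!v. mixed_radix_expansion m N i v) \<and>
    bij_betw (mixed_radix m N) {0..<n} (box m N) \<and>
    card (dots (2 * m) (radix_hyperrectangle m N n g)) = n \<and>
    permutation_costas_hyperrectangle m N (radix_hyperrectangle m N n g)"
proof -
  note n = assms(3) and costas = assms(5)
  let ?V = "mixed_radix m N" and ?R = "radix_value m N" and ?f = "radix_hyperrectangle m N n g"
  define dot where "dot i = vconcat m (?V i) (?V (g i))" for i
  have g: "bij_betw g {0..<n} {0..<n}"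
    using costas by (simp add: costas_permutation_def)
  have g_less: "g i < n" if "i < n" for i
    using bij_betwE[OF g] that by simp
  have V: "bij_betw ?V {0..<n} (box m N)"
    unfolding n by (rule mixed_radix_bij)
  have V_box: "?V i \<in> box m N" and R_V: "?R (?V i) = int i" if "i < n" for i
    using that mixed_radix_in_box radix_value_mixed_radix unfolding n by auto
  have first: "first_half m (dot i) = ?V i" and second: "second_half m (dot i) = ?V (g i)"
    if "i < n" for i
    using that V_box g_less
    by (auto simp: dot_def intro: first_half_vconcat second_half_vconcat)
  have dots: "dots (2 * m) ?f = dot ` {0..<n}"
    unfolding dot_def by (rule dots_radix_hyperrectangle)
  have "inj_on dot {0..<n}"
    using first R_V by (intro inj_onI) (metis atLeastLessThan_iff of_nat_eq_iff)
  then have card: "card (dots (2 * m) ?f) = n"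
    by (simp add: dots card_image)
  have property: "costas_property (2 * m) ?f"
  proof (rule costas_propertyI)
    show "?f \<in> lattice (2 * m) \<rightarrow> {0, 1}"
      by (simp add: radix_hyperrectangle_def)
    show "finite (dots (2 * m) ?f)"
      by (simp add: dots)
    fix w w' k
    assume k: "k \<in> lattice (2 * m)" "k \<noteq> vzero (2 * m)"
      and "w \<in> dots (2 * m) ?f" "w' \<in> dots (2 * m) ?f"
        "vplus (2 * m) w k \<in> dots (2 * m) ?f" "vplus (2 * m) w' k \<in> dots (2 * m) ?f"
    then obtain a b c d where less: "a < n" "b < n" "c < n" "d < n"
      and w: "w = dot a" and w': "w' = dot c"
      and wk: "vplus (2 * m) w k = dot b" and w'k: "vplus (2 * m) w' k = dot d"
      unfolding dots by auto
    have first_diff: "int b = int a + ?R (first_half m k)" "int d = int c + ?R (first_half m k)"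
      using radix_value_first_half_vplus[of m N w k] radix_value_first_half_vplus[of m N w' k]
      by (simp_all only: wk w'k, simp_all add: w w' less first R_V)
    have second_diff: "int (g b) = int (g a) + ?R (second_half m k)"
        "int (g d) = int (g c) + ?R (second_half m k)"
      using radix_value_second_half_vplus[of m N w k] radix_value_second_half_vplus[of m N w' k]
      by (simp_all only: wk w'k, simp_all add: w w' less g_less second R_V)
    have "a \<noteq> b"
    proof
      assume "a = b"
      then have "vplus (2 * m) w k = w"
        using w wk by simp
      then have "k j = 0" if "j \<in> {1..2 * m}" for j
        using that by (auto simp: vplus_def dest!: fun_cong[where x = j])
      then have "k = vzero (2 * m)"
        using k(1) unfolding lattice_def vzero_def by (intro PiE_ext[where k = "{1..2 * m}"]) auto
      with k(2) show False by contradiction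
    qed
    then have "a = c"
      using first_diff second_diff by (intro costas_permutation_difference_inj[OF costas less]) auto
    then show "w = w'"
      by (simp add: w w')
  qed
  define h where "h v = ?V (g (nat (?R v)))" for v
  have R: "bij_betw (\<lambda>v. nat (?R v)) (box m N) {0..<n}"
    by (rule bij_betw_byWitness[where f' = ?V])
      (auto simp: R_V V_box mixed_radix_radix_value(1)[of _ m N, folded n]
        mixed_radix_radix_value(2))
  have h: "bij_betw h (box m N) (box m N)"
    using bij_betw_trans[OF bij_betw_trans[OF R g] V] by (simp add: h_def[abs_def] comp_def)
  have graph: "?f w = 1 \<longleftrightarrow> first_half m w \<in> box m N \<and> second_half m w = h (first_half m w)"
    if w: "w \<in> lattice (2 * m)" for w
  proof -
    have "?f w = 1 \<longleftrightarrow> (\<exists>i<n. w = dot i)"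
      by (auto simp: radix_hyperrectangle_def dot_def)
    also have "\<dots> \<longleftrightarrow> first_half m w \<in> box m N \<and> second_half m w = h (first_half m w)"
    proof
      assume "\<exists>i<n. w = dot i"
      then show "first_half m w \<in> box m N \<and> second_half m w = h (first_half m w)"
        by (auto simp: first second h_def V_box R_V)
    next
      assume half: "first_half m w \<in> box m N \<and> second_half m w = h (first_half m w)"
      define i where "i = nat (?R (first_half m w))"
      have "i < n" "?V i = first_half m w" "?V (g i) = second_half m w"
        using half mixed_radix_radix_value[of "first_half m w" m N]
        by (auto simp: i_def h_def n)
      then show "\<exists>i<n. w = dot i"
        using vconcat_halves[OF w] by (auto simp: dot_def)
    qed
    finally show ?thesis .
  qed
  have "permutation_costas_hyperrectangle m N ?f"
    unfolding permutation_costas_hyperrectangle_def using property h graph by blast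
  moreover have "\<forall>i\<in>{0..<n}. \<exists>!v. mixed_radix_expansion m N i v"
    using mixed_radix_expansion_ex1 n by simp
  ultimately show ?thesis
    using V card by blast
qed

end
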